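(* For any $G\le S_n$, the closure $\overline{\mathrm{Lex}_G}$ of $\mathrm{Lex}_G$ is a fundamental domain for $G$.
   Context: A permutation $g\in S_n$ acts on $\mathbb{R}^n$ by $gx:=(x_{g^{-1}(i)})_{i=1}^n$ (i.e. as a permutation matrix). $\succeq$ is the lexicographic order on $\mathbb{R}^n$: $y\succ x$ iff there is $j\in[n]$ with $y_j>x_j$ and $y_i=x_i$ for all $i<j$; $y\succeq x$ iff $y\succ x$ or $y=x$. $\mathrm{Lex}_G:=\{x\in\mathbb{R}^n: x\succeq gx\ \forall g\in G\}$. A subset $F\subseteq\mathbb{R}^n$ is a fundamental domain for $G$ if (1) $F$ is closed and convex, (2) the sets $\mathrm{int}(gF)$, $g\in G$, are pairwise disjoint, and (3) $\mathbb{R}^n=\bigcup_{g\in G} gF$. *)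

theory Defs
  imports "HOL-Analysis.Analysis" "HOL-Algebra.Bij"
begin

text \<open>
  The index set \<open>[n]\<close> is an arbitrary finite linearly ordered type \<open>'n\<close> with \<open>n = CARD('n)\<close>, and
  \<open>S\<^sub>n\<close> is the group \<^term>\<open>BijGroup (UNIV :: 'n set)\<close> of all bijections of that type.
\<close>

definition perm_act :: "('n \<Rightarrow> 'n) \<Rightarrow> real ^ 'n::finite \<Rightarrow> real ^ 'n::finite" where
  "perm_act g x = (\<chi> i. x $ (inv_into UNIV g i))"

definition lex_greater :: "real ^ 'n::{finite,linorder} \<Rightarrow> real ^ 'n::{finite,linorder} \<Rightarrow> bool"  (infix \<open>\<succ>\<^sub>l\<^sub>e\<^sub>x\<close> 50) where
  "y \<succ>\<^sub>l\<^sub>e\<^sub>x x \<longleftrightarrow> (\<exists>j. y $ j > x $ j \<and> (\<forall>i<j. y $ i = x $ i))"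

definition lex_greater_eq :: "real ^ 'n::{finite,linorder} \<Rightarrow> real ^ 'n::{finite,linorder} \<Rightarrow> bool"  (infix \<open>\<succeq>\<^sub>l\<^sub>e\<^sub>x\<close> 50) where
  "y \<succeq>\<^sub>l\<^sub>e\<^sub>x x \<longleftrightarrow> y \<succ>\<^sub>l\<^sub>e\<^sub>x x \<or> y = x"

definition Lex :: "('n \<Rightarrow> 'n) set \<Rightarrow> (real ^ 'n::{finite,linorder}) set" where
  "Lex G = {x. \<forall>g\<in>G. x \<succeq>\<^sub>l\<^sub>e\<^sub>x perm_act g x}"

definition fundamental_domain :: "('n \<Rightarrow> 'n) set \<Rightarrow> (real ^ 'n::finite) set \<Rightarrow> bool" where
  "fundamental_domain G F \<longleftrightarrow>
     closed F \<and> convex F \<and>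
     (\<forall>g\<in>G. \<forall>h\<in>G. g \<noteq> h \<longrightarrow> interior (perm_act g ` F) \<inter> interior (perm_act h ` F) = {}) \<and>
     (\<Union>g\<in>G. perm_act g ` F) = UNIV"

end

theory Submission imports Defs begin

text \<open>
  The lexicographic order is total and invariant under translation and positive scaling, so
  \<open>Lex G\<close> is convex and contains the lexicographic maximum of every (finite) orbit. Hence its
  translates already cover the space. A convex set has the same interior as its closure, so a
  point \<open>x\<close> in the interiors of the \<open>g\<close>- and \<open>h\<close>-translates of the closure is \<open>g y = h z\<close> with
  \<open>y\<close> and \<open>z\<close> in \<open>Lex G\<close>. These lie in one orbit, so \<open>y = z\<close>, which forces
  \<open>x\<^bsub>g k\<^esub> = x\<^bsub>h k\<^esub>\<close> for all \<open>k\<close>. If \<open>g \<noteq> h\<close> this confines \<open>x\<close> to a hyperplane, which has empty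
  interior.
\<close>

lemma lex_greater_trans:
  assumes "x \<succ>\<^sub>l\<^sub>e\<^sub>x y" "y \<succ>\<^sub>l\<^sub>e\<^sub>x z"
  shows "x \<succ>\<^sub>l\<^sub>e\<^sub>x z"
proof -
  obtain i j where i: "x $ i > y $ i" "\<forall>k<i. x $ k = y $ k"
    and j: "y $ j > z $ j" "\<forall>k<j. y $ k = z $ k"
    using assms by (auto simp: lex_greater_def)
  \<comment> \<open>The earlier of the two deciding positions decides between \<open>x\<close> and
    \<open>z\<close>: before it all three vectors agree, and at it at least one of the two
    comparisons is strict.\<close>
  have "x $ min i j > z $ min i j"
    using i j by (metis (no_types, lifting) linorder_less_linear min.absorb3 min.absorb4 min.idem order_less_trans)
  moreover have "\<forall>k<min i j. x $ k = z $ k"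
    using i j by simp
  ultimately show ?thesis
    unfolding lex_greater_def by blast
qed

lemma lex_greater_irrefl: "\<not> x \<succ>\<^sub>l\<^sub>e\<^sub>x x"
  by (simp add: lex_greater_def)

lemma lex_greater_eq_antisym: "x \<succeq>\<^sub>l\<^sub>e\<^sub>x y \<Longrightarrow> y \<succeq>\<^sub>l\<^sub>e\<^sub>x x \<Longrightarrow> x = y"
  using lex_greater_trans lex_greater_irrefl unfolding lex_greater_eq_def by blast

lemma lex_linear: "x \<succeq>\<^sub>l\<^sub>e\<^sub>x y \<or> y \<succ>\<^sub>l\<^sub>e\<^sub>x x"
proof (cases "x = y")
  case False
  \<comment> \<open>The least position where the vectors differ decides the comparison; it exists
    because the index type is finite.\<close>
  define D where "D = {i. x $ i \<noteq> y $ i}"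
  have "D \<noteq> {}" using False by (auto simp: D_def vec_eq_iff)
  then have "Min D \<in> D" by simp
  moreover have "x $ i = y $ i" if "i < Min D" for i
    using that Min_le[of D i] by (fastforce simp: D_def)
  ultimately show ?thesis
    unfolding lex_greater_eq_def lex_greater_def D_def
    by (metis (mono_tags, lifting) linorder_neqE_linordered_idom mem_Collect_eq)
qed (simp add: lex_greater_eq_def)

lemma lex_greater_eq_scaleR:
  assumes "x \<succeq>\<^sub>l\<^sub>e\<^sub>x y" "c \<ge> 0"
  shows "c *\<^sub>R x \<succeq>\<^sub>l\<^sub>e\<^sub>x c *\<^sub>R y"
proof (cases "c = 0")
  case False
  then show ?thesis
    using assms by (auto simp: lex_greater_eq_def lex_greater_def)
qed (simp add: lex_greater_eq_def)

lemma lex_greater_eq_add: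
  assumes "x \<succeq>\<^sub>l\<^sub>e\<^sub>x y" "u \<succeq>\<^sub>l\<^sub>e\<^sub>x v"
  shows "x + u \<succeq>\<^sub>l\<^sub>e\<^sub>x y + v"
proof -
  \<comment> \<open>Translation by a fixed vector preserves the order, so the summands are exchanged
    one at a time, passing through \<open>y + u\<close>.\<close>
  have 1: "x + u \<succeq>\<^sub>l\<^sub>e\<^sub>x y + u" and 2: "y + u \<succeq>\<^sub>l\<^sub>e\<^sub>x y + v"
    using assms by (auto simp: lex_greater_eq_def lex_greater_def)
  show ?thesis
    using 1 2 lex_greater_trans unfolding lex_greater_eq_def by metis
qed

lemma linear_perm_act: "linear (perm_act g)"
  by (rule linearI) (simp_all add: perm_act_def vec_eq_iff)

text \<open>Inverting a composition reverses its order, so the inverse in \<open>perm_act\<close>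
  makes this a left action.\<close>

lemma perm_act_comp:
  assumes "bij g" "bij h"
  shows "perm_act g (perm_act h x) = perm_act (g \<circ> h) x"
  using assms by (simp add: perm_act_def vec_eq_iff o_inv_distrib)

lemma perm_act_id: "perm_act id x = x"
  by (simp add: perm_act_def vec_eq_iff)

lemma perm_act_inv_cancel:
  assumes "bij g"
  shows "perm_act (inv_into UNIV g) (perm_act g x) = x" "perm_act g (perm_act (inv_into UNIV g) x) = x"
  using assms
  by (simp_all add: perm_act_comp bij_imp_bij_inv perm_act_id bij_is_inj
      surj_iff[THEN iffD1, OF bij_is_surj])

lemma perm_act_nth: "bij g \<Longrightarrow> perm_act g x $ g k = x $ k"
  by (simp add: perm_act_def bij_is_inj)

text \<open>Over \<open>UNIV\<close> the restrictions built into \<open>BijGroup\<close> are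
  vacuous, so its operations are the ordinary ones on functions.\<close>

lemma subgroup_BijGroup_UNIV:
  assumes "subgroup G (BijGroup (UNIV :: 'n set))"
  shows "g \<in> G \<Longrightarrow> bij g" "g \<in> G \<Longrightarrow> h \<in> G \<Longrightarrow> g \<circ> h \<in> G" "g \<in> G \<Longrightarrow> inv_into UNIV g \<in> G" "id \<in> G"
proof -
  have bij: "bij g" if "g \<in> G" for g
    using subgroup.mem_carrier[OF assms that] by (simp add: BijGroup_def Bij_def)
  then show "g \<in> G \<Longrightarrow> bij g" .
  have mult: "g \<otimes>\<^bsub>BijGroup UNIV\<^esub> h = g \<circ> h" if "g \<in> G" "h \<in> G" for g h
    using bij that by (simp add: BijGroup_def Bij_def compose_def comp_def restrict_def)
  show "g \<in> G \<Longrightarrow> h \<in> G \<Longrightarrow> g \<circ> h \<in> G"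
    using subgroup.m_closed[OF assms] mult by metis
  show "g \<in> G \<Longrightarrow> inv_into UNIV g \<in> G"
    using subgroup.m_inv_closed[OF assms, of g] bij[of g]
    by (simp add: inv_BijGroup Bij_def restrict_def)
  show "id \<in> G"
    using subgroup.one_closed[OF assms] by (simp add: BijGroup_def id_def restrict_def)
qed

text \<open>Each \<open>perm_act g\<close> is linear, so the inequalities for \<open>x\<close> and
  \<open>y\<close> can be scaled and added.\<close>

lemma convex_Lex:
  fixes G :: "('n::{finite,linorder} \<Rightarrow> 'n) set"
  shows "convex (Lex G)"
proof (rule convexI)
  fix x y :: "(real, 'n) vec" and u v :: real
  assume *: "x \<in> Lex G" "y \<in> Lex G" "0 \<le> u" "0 \<le> v"
  have "u *\<^sub>R x + v *\<^sub>R y \<succeq>\<^sub>l\<^sub>e\<^sub>x perm_act g (u *\<^sub>R x + v *\<^sub>R y)" if "g \<in> G" for g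
  proof -
    have "u *\<^sub>R x + v *\<^sub>R y \<succeq>\<^sub>l\<^sub>e\<^sub>x u *\<^sub>R perm_act g x + v *\<^sub>R perm_act g y"
      using * that by (intro lex_greater_eq_add lex_greater_eq_scaleR) (auto simp: Lex_def)
    then show ?thesis
      by (simp add: linear_add linear_scale linear_perm_act)
  qed
  then show "u *\<^sub>R x + v *\<^sub>R y \<in> Lex G"
    by (simp add: Lex_def)
qed

lemma ex_perm_act_in_Lex:
  fixes G :: "('n::{finite,linorder} \<Rightarrow> 'n) set"
  assumes "subgroup G (BijGroup (UNIV :: 'n set))"
  shows "\<exists>g\<in>G. perm_act g x \<in> Lex G"
proof -
  note G = subgroup_BijGroup_UNIV[OF assms]
  define orb where "orb = (\<lambda>g. perm_act g x) ` G"
  have "finite orb" "orb \<noteq> {}"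
    using G(4) by (auto simp: orb_def)
  \<comment> \<open>The arguments are swapped so that the relation reads as "smaller than" and a
    maximal element is lexicographically greatest.\<close>
  moreover have "asymp_on orb (\<lambda>y z. z \<succ>\<^sub>l\<^sub>e\<^sub>x y)" "transp_on orb (\<lambda>y z. z \<succ>\<^sub>l\<^sub>e\<^sub>x y)"
    using lex_greater_trans lex_greater_irrefl by (blast intro: asymp_onI transp_onI)+
  ultimately obtain m where m: "m \<in> orb" "\<forall>y\<in>orb. y \<noteq> m \<longrightarrow> \<not> y \<succ>\<^sub>l\<^sub>e\<^sub>x m"
    using Finite_Set.bex_max_element[of orb "\<lambda>y z. z \<succ>\<^sub>l\<^sub>e\<^sub>x y"] by blast
  then obtain g where g: "g \<in> G" "m = perm_act g x"
    by (auto simp: orb_def)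
  have "m \<succeq>\<^sub>l\<^sub>e\<^sub>x perm_act h m" if "h \<in> G" for h
  proof -
    have "perm_act h m \<in> orb"
      using g that G by (auto simp: orb_def perm_act_comp)
    then show ?thesis
      using m lex_linear lex_greater_irrefl by metis
  qed
  then show ?thesis
    using g by (auto simp: Lex_def)
qed

lemma Lex_orbit_unique:
  fixes G :: "('n::{finite,linorder} \<Rightarrow> 'n) set"
  assumes "subgroup G (BijGroup (UNIV :: 'n set))"
    and "g \<in> G" "h \<in> G" "y \<in> Lex G" "z \<in> Lex G" "perm_act g y = perm_act h z"
  shows "y = z"
proof -
  note G = subgroup_BijGroup_UNIV[OF assms(1)]
  \<comment> \<open>Here \<open>b\<close> is the image of \<open>a\<close> under an element of
    \<open>G\<close>. Using this with the roles of \<open>y\<close> and \<open>z\<close> exchanged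
    gives both inequalities, and antisymmetry concludes.\<close>
  have "a \<succeq>\<^sub>l\<^sub>e\<^sub>x b"
    if "p \<in> G" "q \<in> G" "a \<in> Lex G" "perm_act p a = perm_act q b" for p q a b
  proof -
    have "perm_act (inv_into UNIV q \<circ> p) a = perm_act (inv_into UNIV q) (perm_act q b)"
      using that G by (simp flip: perm_act_comp)
    also have "\<dots> = b"
      using that G by (simp add: perm_act_inv_cancel)
    finally have "b = perm_act (inv_into UNIV q \<circ> p) a" ..
    with that G show ?thesis by (simp add: Lex_def)
  qed
  then show ?thesis
    using assms lex_greater_eq_antisym by metis
qed

lemma interior_perm_act_closure_Lex_subset:
  "interior (perm_act g ` closure (Lex G)) \<subseteq> perm_act g ` Lex G"
proof -
  \<comment> \<open>By continuity the closure moves outside the image; the image is still convex, so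
    this closure adds no interior points.\<close>
  have "perm_act g ` closure (Lex G) \<subseteq> closure (perm_act g ` Lex G)"
    by (rule closure_bounded_linear_image_subset)
      (simp add: linear_perm_act linear_conv_bounded_linear[symmetric])
  then have "interior (perm_act g ` closure (Lex G)) \<subseteq> interior (perm_act g ` Lex G)"
    using interior_mono convex_interior_closure convex_linear_image linear_perm_act convex_Lex
    by metis
  then show ?thesis
    using interior_subset by blast
qed

lemma disjoint_interior_perm_act_closure_Lex:
  fixes G :: "('n::{finite,linorder} \<Rightarrow> 'n) set"
  assumes "subgroup G (BijGroup (UNIV :: 'n set))" "g \<in> G" "h \<in> G" "g \<noteq> h"
  shows "interior (perm_act g ` closure (Lex G)) \<inter> interior (perm_act h ` closure (Lex G)) = {}"
    (is "?U = {}")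
proof -
  note G = subgroup_BijGroup_UNIV[OF assms(1)]
  obtain k where k: "g k \<noteq> h k"
    using \<open>g \<noteq> h\<close> by auto
  \<comment> \<open>A normal vector of the hyperplane where the coordinates \<open>g k\<close> and
    \<open>h k\<close> agree.\<close>
  define a :: "(real, 'n) vec" where "a = axis (g k) 1 - axis (h k) 1"
  have "a $ g k = 1"
    using k by (simp add: a_def axis_def)
  then have "a \<noteq> 0" by auto
  have "?U \<subseteq> {x. a \<bullet> x = 0}"
  proof
    fix x assume "x \<in> ?U"
    then obtain y z where yz: "y \<in> Lex G" "z \<in> Lex G" "x = perm_act g y" "x = perm_act h z"
      using interior_perm_act_closure_Lex_subset by blast
    then have "y = z"
      using Lex_orbit_unique assms by metis
    \<comment> \<open>Both sides equal \<open>y $ k\<close>.\<close>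
    with yz have "x $ g k = x $ h k"
      using G assms perm_act_nth by metis
    then show "x \<in> {x. a \<bullet> x = 0}"
      by (simp add: a_def inner_diff_left inner_axis')
  qed
  \<comment> \<open>\<open>?U\<close> is open, being an intersection of two interiors.\<close>
  then have "?U \<subseteq> interior {x. a \<bullet> x = 0}"
    by (simp add: interior_maximal open_Int)
  then show ?thesis
    using interior_hyperplane[OF \<open>a \<noteq> 0\<close>] by blast
qed

theorem theorem3:
  fixes G :: "('n::{finite,linorder} \<Rightarrow> 'n) set"
  assumes "subgroup G (BijGroup (UNIV :: 'n set))"
  shows "fundamental_domain G (closure (Lex G))"
proof -
  note G = subgroup_BijGroup_UNIV[OF assms]
  have "x \<in> (\<Union>g\<in>G. perm_act g ` closure (Lex G))" for x
  proof -
    obtain g where g: "g \<in> G" "perm_act g x \<in> Lex G"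
      using ex_perm_act_in_Lex[OF assms] by blast
    then have "x = perm_act (inv_into UNIV g) (perm_act g x)"
      using G by (simp add: perm_act_inv_cancel)
    then show ?thesis
      using g G(3) closure_subset by blast
  qed
  then show ?thesis
    unfolding fundamental_domain_def
    using convex_Lex convex_closure disjoint_interior_perm_act_closure_Lex[OF assms] by blast
qed

end
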